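(* Let $k$ be a positive integer and let $G=(V,E)$ be a $k$-vertex-critical digraph with $|V|\leq 2k-2$. Then the complement $\overline G$ is disconnected.
   Context: A digraph $G=(V,E)$ is finite, with $E\subseteq \{(u,v): u,v\in V, u\neq v\}$ (loopless, at most one arc in each direction between two vertices). A colouring of $G$ is a partition of $V$ into parts (colour classes) each of which induces an acyclic subdigraph (contains no directed cycle; a pair of opposite arcs $(u,v),(v,u)$ counts as a directed cycle of length 2). The dichromatic number $\chi(G)$ is the minimum number of colour classes in a colouring of $G$. $G$ is $k$-vertex-critical if $\chi(G)=k$ and every proper induced subdigraph $G'$ of $G$ satisfies $\chi(G')<k$. The complement $\overline G$ is the digraph on $V$ in which, for distinct $u,v$, $(u,v)$ is an arc iff $(u,v)\notin E$. $\overline G$ is disconnected if its underlying undirected graph is disconnected. *)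

theory Defs
  imports "Graph_Theory.Digraph_Component" "HOL-Library.Disjoint_Sets"
begin

text \<open>
  The library's \<^const>\<open>pre_digraph.cycle\<close> is a directed cycle of any length at least 1; in
  particular, a pair of opposite arcs is a cycle.
\<close>

definition acyclic_colouring :: "('a, 'b) pre_digraph \<Rightarrow> 'a set set \<Rightarrow> bool" where
  "acyclic_colouring G P \<longleftrightarrow>
     partition_on (verts G) P \<and> (\<forall>C\<in>P. \<not> (\<exists>c. pre_digraph.cycle (induce_subgraph G C) c))"

text \<open>
  A finite loopless digraph always has a colouring (into singletons), and all its colourings are
  finite, so the minimum below is attained and \<^const>\<open>card\<close> is the genuine number of classes.
\<close>

definition dichromatic_number :: "('a, 'b) pre_digraph \<Rightarrow> nat" where
  "dichromatic_number G = (LEAST n. \<exists>P. acyclic_colouring G P \<and> card P = n)"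

definition vertex_critical :: "nat \<Rightarrow> ('a, 'b) pre_digraph \<Rightarrow> bool" where
  "vertex_critical k G \<longleftrightarrow>
     dichromatic_number G = k \<and>
     (\<forall>H. induced_subgraph H G \<and> H \<noteq> G \<longrightarrow> dichromatic_number H < k)"

definition complement_digraph :: "'a pair_pre_digraph \<Rightarrow> 'a pair_pre_digraph" where
  "complement_digraph G =
     \<lparr> pverts = pverts G,
       parcs = {(u, v). u \<in> pverts G \<and> v \<in> pverts G \<and> u \<noteq> v \<and> (u, v) \<notin> parcs G} \<rparr>"

end

theory Submission
  imports Defs
begin

text \<open>
  The acyclic vertex sets form a simplicial complex whose 1-skeleton is the underlying graph of the
  complement, and the dichromatic number is the least number of faces covering the vertices. So it
  suffices to show, for any finite complex on \<open>X\<close> with connected 1-skeleton whose cover number \<open>f\<close>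
  drops whenever a vertex is removed, that \<open>2 f(X) \<le> |X| + 1\<close>; this goes by induction on \<open>|X|\<close>.

  Suppose \<open>2 f(X) \<ge> |X| + 2\<close>. Remove a vertex \<open>x\<close> and choose a minimal \<open>Y \<subseteq> X - x\<close> with
  \<open>f(Y) = f(X) - 1\<close>. The components \<open>C\<close> of the 1-skeleton on \<open>Y\<close> are again critical, \<open>f\<close> is additive
  over them, and \<open>2 f(C) \<le> |C| + 1\<close> by induction; hence there are at least as many components as
  vertices in \<open>R = X - Y\<close>. As every component has a neighbour in \<open>R\<close>, Hall's theorem yields a
  nonempty \<open>Q \<subseteq> R\<close> matched injectively to adjacent components that have no neighbours in \<open>R - Q\<close>.
  If \<open>q\<close> is adjacent to \<open>c \<in> C\<close>, criticality of \<open>C\<close> gives \<open>f(C + q) \<le> f(C - c) + f({q, c}) \<le> f(C)\<close>,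
  so all of \<open>Q\<close> can be absorbed without new faces: \<open>f(X) \<le> f(X - Q)\<close>, contradicting criticality.
\<close>

section \<open>Hall's theorem and matchings saturated on one side\<close>

lemma hall_marriage:
  fixes N :: "'i \<Rightarrow> 'd set"
  assumes "finite I" and "\<And>i. i \<in> I \<Longrightarrow> finite (N i)"
    and "\<And>J. J \<subseteq> I \<Longrightarrow> card J \<le> card (\<Union>(N ` J))"
  shows "\<exists>m. inj_on m I \<and> (\<forall>i\<in>I. m i \<in> N i)"
  using assms
proof (induction "card I" arbitrary: I N rule: less_induct)
  case less
  have finN: "finite (\<Union>(N ` J))" if "J \<subseteq> I" for J
    using that less.prems(1,2) by (auto intro: finite_subset)
  \<comment> \<open>The dichotomy of Halmos and Vaughan: a nonempty proper tight subfamily is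
    matched inside its own neighbourhood and the rest outside it; if every such subfamily has a
    surplus, one element may be matched arbitrarily.\<close>
  consider (empty) "I = {}"
    | (tight) J where "J \<subset> I" "J \<noteq> {}" "card (\<Union>(N ` J)) \<le> card J"
    | (loose) "I \<noteq> {}" "\<And>J. J \<subset> I \<Longrightarrow> J \<noteq> {} \<Longrightarrow> card J < card (\<Union>(N ` J))"
    by (meson not_le)
  then show ?case
  proof cases
    case empty
    then show ?thesis by simp
  next
    case tight
    let ?U = "\<Union>(N ` J)"
    have finJ: "finite J" using tight(1) less.prems(1) by (auto intro: finite_subset)
    have "\<exists>m. inj_on m J \<and> (\<forall>i\<in>J. m i \<in> N i)"
    proof (rule less.hyps)
      show "card J < card I" using tight(1) less.prems(1) by (rule psubset_card_mono[rotated])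
    qed (use tight(1) less.prems finJ in auto)
    then obtain m where m: "inj_on m J" "\<And>i. i \<in> J \<Longrightarrow> m i \<in> N i" by blast
    have "\<exists>m. inj_on m (I - J) \<and> (\<forall>i\<in>I - J. m i \<in> N i - ?U)"
    proof (rule less.hyps)
      show "card (I - J) < card I" using tight(1,2) less.prems(1) by (intro psubset_card_mono) auto
      fix K assume K: "K \<subseteq> I - J"
      \<comment> \<open>Hall's condition survives the removal of \<open>?U\<close>: apply it to
        \<open>K \<union> J\<close> and subtract the tight set \<open>J\<close>, which accounts for
        all of \<open>?U\<close>.\<close>
      have "card K + card J = card (K \<union> J)"
        using K finJ less.prems(1) by (subst card_Un_disjoint) (auto intro: finite_subset)
      also have "\<dots> \<le> card (\<Union>(N ` (K \<union> J)))"
        using K tight(1) by (intro less.prems(3)) auto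
      also have "\<Union>(N ` (K \<union> J)) = \<Union>((\<lambda>i. N i - ?U) ` K) \<union> ?U" by auto
      also have "card \<dots> \<le> card (\<Union>((\<lambda>i. N i - ?U) ` K)) + card ?U" by (rule card_Un_le)
      finally show "card K \<le> card (\<Union>((\<lambda>i. N i - ?U) ` K))" using tight(3) by simp
    qed (use less.prems in auto)
    then obtain m' where m': "inj_on m' (I - J)" "\<And>i. i \<in> I - J \<Longrightarrow> m' i \<in> N i - ?U" by blast
    have "inj_on (\<lambda>i. if i \<in> J then m i else m' i) I"
    proof (rule inj_onI)
      fix i j assume "i \<in> I" "j \<in> I" "(if i \<in> J then m i else m' i) = (if j \<in> J then m j else m' j)"
      then show "i = j"
        using m' m by (cases "i \<in> J"; cases "j \<in> J") (auto dest: inj_onD, (metis Diff_iff UN_I)+)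
    qed
    with m(2) m'(2) show ?thesis
      by (intro exI[of _ "\<lambda>i. if i \<in> J then m i else m' i"]) auto
  next
    case loose
    obtain i where i: "i \<in> I" using loose(1) by blast
    have "N i \<noteq> {}" using less.prems(3)[of "{i}"] i by auto
    then obtain d where d: "d \<in> N i" by blast
    have "\<exists>m. inj_on m (I - {i}) \<and> (\<forall>j\<in>I - {i}. m j \<in> N j - {d})"
    proof (rule less.hyps)
      show "card (I - {i}) < card I" using i less.prems(1) by (rule card_Diff1_less[rotated])
      fix K assume K: "K \<subseteq> I - {i}"
      show "card K \<le> card (\<Union>((\<lambda>j. N j - {d}) ` K))"
      proof (cases "K = {}")
        case False
        \<comment> \<open>Since \<open>K\<close> omits \<open>i\<close>, it is a proper subfamily,
          and its strict surplus pays for the loss of \<open>d\<close>.\<close>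
        have "card K < card (\<Union>(N ` K))" using loose(2) K i False by blast
        moreover have "card (\<Union>((\<lambda>j. N j - {d}) ` K)) = card (\<Union>(N ` K) - {d})"
          by (rule arg_cong[where f = card]) auto
        moreover have "card (\<Union>(N ` K)) - 1 \<le> card (\<Union>(N ` K) - {d})"
          by (simp add: card_Diff_singleton_if)
        ultimately show ?thesis by linarith
      qed simp
    qed (use less.prems in auto)
    then obtain m where m: "inj_on m (I - {i})" "\<And>j. j \<in> I - {i} \<Longrightarrow> m j \<in> N j - {d}" by blast
    have "inj_on (m(i := d)) I"
      using m by (auto simp: inj_on_def)
    with m(2) d show ?thesis by (intro exI[of _ "m(i := d)"]) auto
  qed
qed

text \<open>Choose \<open>Q\<close> of least size among the nonempty subsets of \<open>R\<close>
  that contain at least \<open>card Q\<close> of the sets \<open>Nb d\<close>. A set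
  \<open>J\<close> violating Hall's condition could be deleted: the sets inside \<open>Q\<close>
  that are lost are exactly those meeting \<open>J\<close>, fewer than \<open>card J\<close>, so
  \<open>Q - J\<close> would be a smaller choice.\<close>

lemma saturated_matching_exists:
  fixes Nb :: "'d \<Rightarrow> 'r set"
  assumes "finite R" "R \<noteq> {}" "finite D" "card R \<le> card D"
    and Nb: "\<And>d. d \<in> D \<Longrightarrow> Nb d \<noteq> {}" "\<And>d. d \<in> D \<Longrightarrow> Nb d \<subseteq> R"
  shows "\<exists>Q m. Q \<noteq> {} \<and> Q \<subseteq> R \<and> inj_on m Q \<and> (\<forall>q\<in>Q. m q \<in> D \<and> q \<in> Nb (m q) \<and> Nb (m q) \<subseteq> Q)"
proof -
  define M where "M Q = {d \<in> D. Nb d \<subseteq> Q}" for Q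
  have finM: "finite (M Q)" for Q using \<open>finite D\<close> by (simp add: M_def)
  have "M R = D" using Nb(2) by (auto simp: M_def)
  define good where "good Q \<longleftrightarrow> Q \<noteq> {} \<and> Q \<subseteq> R \<and> card Q \<le> card (M Q)" for Q
  have "good R" using \<open>M R = D\<close> assms by (simp add: good_def)
  then obtain Q where "good Q" and min: "\<And>Q'. good Q' \<Longrightarrow> card Q \<le> card Q'"
    using ex_has_least_nat[of good R card] by auto
  then have Q: "Q \<noteq> {}" "Q \<subseteq> R" "card Q \<le> card (M Q)" by (auto simp: good_def)
  have finQ: "finite Q" using Q(2) \<open>finite R\<close> by (rule finite_subset)
  define N where "N q = {d \<in> M Q. q \<in> Nb d}" for q
  have "\<exists>m. inj_on m Q \<and> (\<forall>q\<in>Q. m q \<in> N q)"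
  proof (rule hall_marriage[OF finQ])
    fix J assume J: "J \<subseteq> Q"
    let ?U = "\<Union>(N ` J)"
    show "card J \<le> card ?U"
    proof (rule ccontr)
      assume less: "\<not> card J \<le> card ?U"
      have finJ: "finite J" using J finQ by (rule finite_subset)
      have "M (Q - J) = M Q - ?U" by (auto simp: M_def N_def)
      then have "card (M (Q - J)) \<ge> card (M Q) - card ?U"
        by (metis diff_card_le_card_Diff finM finite_subset N_def UN_least mem_Collect_eq subsetI)
      moreover have "card (Q - J) = card Q - card J" using finJ J by (rule card_Diff_subset)
      ultimately have ge: "card (Q - J) \<le> card (M (Q - J))" using less Q(3) by linarith
      \<comment> \<open>Nonemptiness of the \<open>Nb d\<close> enters here: every index in
        \<open>M Q\<close> is then a neighbour of some point of \<open>Q\<close>, so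
        \<open>Q\<close> itself cannot violate Hall's condition.\<close>
      have "J \<noteq> Q"
      proof
        assume "J = Q"
        then have "?U = M Q" using Nb(1) by (fastforce simp: M_def N_def)
        with less Q(3) \<open>J = Q\<close> show False by simp
      qed
      with J have "Q - J \<noteq> {}" by auto
      with ge Q(2) have "card Q \<le> card (Q - J)" by (intro min) (auto simp: good_def)
      moreover have "card (Q - J) < card Q"
        using less finJ J finQ by (cases "J = {}") (auto intro!: psubset_card_mono)
      ultimately show False by simp
    qed
  qed (simp add: N_def finM)
  then obtain m where "inj_on m Q" "\<forall>q\<in>Q. m q \<in> N q" by auto
  with Q(1,2) show ?thesis by (intro exI[of _ Q] exI[of _ m]) (simp add: N_def M_def)
qed

section \<open>Covers by faces of a finite simplicial complex\<close>

locale face_family =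
  fixes V :: "'a set" and F :: "'a set \<Rightarrow> bool"
  assumes finite_V: "finite V"
    and singleton_face: "x \<in> V \<Longrightarrow> F {x}"
    and face_subset: "F A \<Longrightarrow> B \<subseteq> A \<Longrightarrow> F B"
begin

text \<open>Faces may overlap and stick out of \<open>X\<close>. Hence a cover of a set also covers
  its subsets, and covers can be united without making them disjoint; partitions are recovered in
  \<open>partition_into_faces_exists\<close>.\<close>

definition covers :: "'a set set \<Rightarrow> 'a set \<Rightarrow> bool" where
  "covers P X \<longleftrightarrow> finite P \<and> X \<subseteq> \<Union>P \<and> (\<forall>C\<in>P. F C)"

definition cover_number :: "'a set \<Rightarrow> nat" where
  "cover_number X = (LEAST n. \<exists>P. covers P X \<and> card P = n)"

text \<open>Connectedness is stated through cuts rather than paths, since it is used only to find an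
  edge leaving a given set. The empty set counts as connected.\<close>

definition skeleton_connected :: "'a set \<Rightarrow> bool" where
  "skeleton_connected X \<longleftrightarrow> (\<forall>A. A \<subseteq> X \<and> A \<noteq> {} \<and> A \<noteq> X \<longrightarrow> (\<exists>a\<in>A. \<exists>b\<in>X - A. F {a, b}))"

text \<open>The case \<open>a = b\<close> is included on purpose: singletons of \<open>V\<close> are
  faces, so apart subsets of \<open>V\<close> are disjoint.\<close>

definition apart :: "'a set \<Rightarrow> 'a set \<Rightarrow> bool" where
  "apart A B \<longleftrightarrow> (\<forall>a\<in>A. \<forall>b\<in>B. \<not> F {a, b})"

definition cover_critical :: "'a set \<Rightarrow> bool" where
  "cover_critical X \<longleftrightarrow> (\<forall>x\<in>X. cover_number (X - {x}) < cover_number X)"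

lemma finite_subset_V: "X \<subseteq> V \<Longrightarrow> finite X"
  using finite_V by (rule finite_subset[rotated])

lemma cover_number_le: "covers P X \<Longrightarrow> cover_number X \<le> card P"
  unfolding cover_number_def by (rule Least_le) blast

lemma minimum_cover_exists:
  assumes "X \<subseteq> V"
  obtains P where "covers P X" "card P = cover_number X"
proof -
  have "covers ((\<lambda>x. {x}) ` X) X"
    using assms singleton_face finite_subset_V by (auto simp: covers_def)
  then have "\<exists>n P. covers P X \<and> card P = n" by blast
  then have "\<exists>P. covers P X \<and> card P = cover_number X"
    unfolding cover_number_def by (rule LeastI_ex)
  with that show ?thesis by blast
qed

lemma cover_number_empty [simp]: "cover_number {} = 0"
  using cover_number_le[of "{}" "{}"] by (simp add: covers_def)

lemma cover_number_face: "F C \<Longrightarrow> cover_number C \<le> 1"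
  using cover_number_le[of "{C}" C] by (simp add: covers_def)

lemma cover_number_mono:
  assumes "X \<subseteq> Y" "Y \<subseteq> V" shows "cover_number X \<le> cover_number Y"
proof -
  obtain P where "covers P Y" "card P = cover_number Y" using assms(2) by (rule minimum_cover_exists)
  with assms(1) show ?thesis using cover_number_le[of P X] by (auto simp: covers_def)
qed

lemma cover_number_Un_le:
  assumes "X \<subseteq> V" "Y \<subseteq> V" shows "cover_number (X \<union> Y) \<le> cover_number X + cover_number Y"
proof -
  obtain P where P: "covers P X" "card P = cover_number X" using assms(1) by (rule minimum_cover_exists)
  obtain Q where Q: "covers Q Y" "card Q = cover_number Y" using assms(2) by (rule minimum_cover_exists)
  have "covers (P \<union> Q) (X \<union> Y)" using P(1) Q(1) by (auto simp: covers_def)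
  then have "cover_number (X \<union> Y) \<le> card (P \<union> Q)" by (rule cover_number_le)
  also have "\<dots> \<le> card P + card Q" by (rule card_Un_le)
  finally show ?thesis using P(2) Q(2) by simp
qed

lemma cover_number_UN_le:
  assumes "finite I" "\<And>i. i \<in> I \<Longrightarrow> X i \<subseteq> V"
  shows "cover_number (\<Union>(X ` I)) \<le> (\<Sum>i\<in>I. cover_number (X i))"
  using assms
proof (induction I rule: finite_induct)
  case (insert i I)
  have "cover_number (X i \<union> \<Union>(X ` I)) \<le> cover_number (X i) + cover_number (\<Union>(X ` I))"
    using insert.prems by (intro cover_number_Un_le) auto
  with insert show ?case by fastforce
qed simp

text \<open>A face meeting both sides would contain an edge between them. So the members of a
  minimum cover that meet \<open>A\<close> and those that meet \<open>B\<close> form disjoint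
  subfamilies, each covering its side.\<close>

lemma cover_number_Un_apart:
  assumes "A \<subseteq> V" "B \<subseteq> V" "apart A B"
  shows "cover_number (A \<union> B) = cover_number A + cover_number B"
proof (rule antisym)
  obtain P where P: "covers P (A \<union> B)" "card P = cover_number (A \<union> B)"
    using assms(1,2) minimum_cover_exists[of "A \<union> B"] by blast
  define PA where "PA = {C \<in> P. C \<inter> A \<noteq> {}}"
  define PB where "PB = {C \<in> P. C \<inter> B \<noteq> {}}"
  have fin: "finite P" using P(1) by (simp add: covers_def)
  have "covers PA A" "covers PB B"
    using P(1) unfolding covers_def PA_def PB_def by (simp, blast)+
  then have "cover_number A + cover_number B \<le> card PA + card PB"
    by (intro add_mono cover_number_le)
  also have "\<dots> = card (PA \<union> PB)"
  proof (rule card_Un_disjoint[symmetric])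
    show "PA \<inter> PB = {}"
    proof (rule ccontr)
      assume "PA \<inter> PB \<noteq> {}"
      then obtain C a b where "C \<in> P" "a \<in> C" "a \<in> A" "b \<in> C" "b \<in> B" by (auto simp: PA_def PB_def)
      moreover from this P(1) have "F {a, b}"
        using face_subset[of C "{a, b}"] by (auto simp: covers_def)
      ultimately show False using assms(3) by (auto simp: apart_def)
    qed
  qed (use fin in \<open>auto simp: PA_def PB_def\<close>)
  also have "\<dots> \<le> card P" using fin by (intro card_mono) (auto simp: PA_def PB_def)
  finally show "cover_number A + cover_number B \<le> cover_number (A \<union> B)" using P(2) by simp
qed (use assms cover_number_Un_le in auto)

lemma cover_number_UN_apart:
  assumes "finite I" "\<And>i. i \<in> I \<Longrightarrow> X i \<subseteq> V"
    and "\<And>i j. i \<in> I \<Longrightarrow> j \<in> I \<Longrightarrow> i \<noteq> j \<Longrightarrow> apart (X i) (X j)"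
  shows "cover_number (\<Union>(X ` I)) = (\<Sum>i\<in>I. cover_number (X i))"
  using assms
proof (induction I rule: finite_induct)
  case (insert i I)
  have "apart (X i) (\<Union>(X ` I))"
    using insert.prems(2)[of i] insert.hyps(2) unfolding apart_def by blast
  then have "cover_number (X i \<union> \<Union>(X ` I)) = cover_number (X i) + cover_number (\<Union>(X ` I))"
    using insert.prems(1) by (intro cover_number_Un_apart) auto
  with insert show ?case by simp
qed simp

text \<open>A set that is not connected has a cut crossed by no edge; both sides are smaller and are
  decomposed by induction.\<close>

lemma components_exist:
  assumes "X \<subseteq> V"
  shows "\<exists>P. partition_on X P \<and> (\<forall>C\<in>P. skeleton_connected C) \<and>
    (\<forall>C\<in>P. \<forall>D\<in>P. C \<noteq> D \<longrightarrow> apart C D)"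
  using assms
proof (induction "card X" arbitrary: X rule: less_induct)
  case less
  consider (empty) "X = {}" | (conn) "X \<noteq> {}" "skeleton_connected X"
    | (split) A where "A \<subseteq> X" "A \<noteq> {}" "A \<noteq> X" "apart A (X - A)"
    unfolding skeleton_connected_def apart_def by blast
  then show ?case
  proof cases
    case empty
    then show ?thesis by (intro exI[of _ "{}"]) (simp add: partition_on_def)
  next
    case conn
    then show ?thesis by (intro exI[of _ "{X}"]) (simp add: partition_on_def)
  next
    case split
    have fin: "finite X" using less.prems by (rule finite_subset_V)
    have "card A < card X" "card (X - A) < card X"
      using split fin by (auto intro!: psubset_card_mono)
    moreover have "A \<subseteq> V" "X - A \<subseteq> V" using split(1) less.prems by auto
    ultimately obtain P Q where P: "partition_on A P" "\<forall>C\<in>P. skeleton_connected C"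
        "\<forall>C\<in>P. \<forall>D\<in>P. C \<noteq> D \<longrightarrow> apart C D"
      and Q: "partition_on (X - A) Q" "\<forall>C\<in>Q. skeleton_connected C"
        "\<forall>C\<in>Q. \<forall>D\<in>Q. C \<noteq> D \<longrightarrow> apart C D"
      using less.hyps[of A] less.hyps[of "X - A"] by auto
    have "disjoint (P \<union> Q)"
      using P(1) Q(1) by (intro disjoint_union) (auto simp: partition_on_def)
    then have part: "partition_on X (P \<union> Q)"
      using P(1) Q(1) split(1) by (auto simp: partition_on_def)
    have PQ: "apart C D \<and> apart D C" if "C \<in> P" "D \<in> Q" for C D
    proof -
      have "C \<subseteq> A" "D \<subseteq> X - A" using that P(1) Q(1) by (auto simp: partition_on_def)
      with split(4) show ?thesis unfolding apart_def by (metis insert_commute subsetD)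
    qed
    show ?thesis
    proof (intro exI[of _ "P \<union> Q"] conjI part ballI impI)
      show "skeleton_connected C" if "C \<in> P \<union> Q" for C using that P(2) Q(2) by auto
      show "apart C D" if "C \<in> P \<union> Q" "D \<in> P \<union> Q" "C \<noteq> D" for C D
        using that P(3) Q(3) PQ by (elim UnE) simp_all
    qed
  qed
qed

lemma cover_critical_diff:
  assumes "X \<subseteq> V" "cover_critical X" "Q \<subseteq> X" "Q \<noteq> {}"
  shows "cover_number (X - Q) < cover_number X"
proof -
  obtain q where q: "q \<in> Q" using assms(4) by blast
  have "cover_number (X - Q) \<le> cover_number (X - {q})"
    using q assms(1) by (intro cover_number_mono) auto
  also have "\<dots> < cover_number X" using q assms(2,3) by (auto simp: cover_critical_def)
  finally show ?thesis .
qed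

section \<open>The bound for critical sets with connected 1-skeleton\<close>

theorem twice_cover_number_le:
  assumes "X \<subseteq> V" "skeleton_connected X" "cover_critical X"
  shows "2 * cover_number X \<le> card X + 1"
  using assms
proof (induction "card X" arbitrary: X rule: less_induct)
  case less
  note XV = less.prems(1)
  have finX: "finite X" using XV by (rule finite_subset_V)
  show ?case
  proof (rule ccontr)
    assume "\<not> ?thesis"
    then have large: "card X + 2 \<le> 2 * cover_number X" by simp
    then have "X \<noteq> {}" by auto
    then obtain x where x: "x \<in> X" by blast
    define k where "k = cover_number (X - {x})"
    have "cover_number X = cover_number ((X - {x}) \<union> {x})" using x by (simp add: insert_absorb)
    also have "\<dots> \<le> k + cover_number {x}"
      unfolding k_def using XV x by (intro cover_number_Un_le) auto
    also have "cover_number {x} \<le> 1" using x XV by (intro cover_number_face singleton_face) auto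
    finally have k: "cover_number X \<le> k + 1" by simp
    \<comment> \<open>Least cardinality makes \<open>Y\<close> critical: deleting a further vertex
      cannot preserve the value \<open>k\<close>, and by monotonicity the value can only
      fall.\<close>
    define good where "good Y \<longleftrightarrow> Y \<subseteq> X - {x} \<and> cover_number Y = k" for Y
    have "good (X - {x})" by (simp add: good_def k_def)
    then obtain Y where "good Y" and min: "\<And>Z. good Z \<Longrightarrow> card Y \<le> card Z"
      using ex_has_least_nat[of good "X - {x}" card] by auto
    then have Y: "Y \<subseteq> X - {x}" "cover_number Y = k" by (auto simp: good_def)
    have YV: "Y \<subseteq> V" using Y(1) XV by auto
    have finY: "finite Y" using YV by (rule finite_subset_V)
    have critY: "cover_critical Y"
      unfolding cover_critical_def
    proof
      fix y assume y: "y \<in> Y"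
      have "cover_number (Y - {y}) \<noteq> k"
        using min[of "Y - {y}"] y Y(1) card_Diff1_less[OF finY y] by (auto simp: good_def)
      moreover have "cover_number (Y - {y}) \<le> cover_number Y"
        using YV by (intro cover_number_mono) auto
      ultimately show "cover_number (Y - {y}) < cover_number Y" using Y(2) by simp
    qed
    define R where "R = X - Y"
    have R: "finite R" "R \<noteq> {}" using x Y(1) finX by (auto simp: R_def)
    obtain P where P: "partition_on Y P" and conn: "\<forall>C\<in>P. skeleton_connected C"
      and "\<forall>C\<in>P. \<forall>D\<in>P. C \<noteq> D \<longrightarrow> apart C D"
      using components_exist[OF YV] by auto
    then have apart: "\<And>C D. C \<in> P \<Longrightarrow> D \<in> P \<Longrightarrow> C \<noteq> D \<Longrightarrow> apart C D" by simp
    have finP: "finite P" using finite_elements[OF finY P] .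
    have PY: "C \<subseteq> Y" if "C \<in> P" for C using that P by (auto simp: partition_on_def)
    have PV: "C \<subseteq> V" if "C \<in> P" for C using PY[OF that] YV by auto
    have UP: "\<Union>P = Y" using P by (simp add: partition_on_def)
    have kP: "k = (\<Sum>C\<in>P. cover_number C)"
      using cover_number_UN_apart[of P "\<lambda>C. C"] finP PV apart UP Y(2) by simp
    have critP: "cover_critical C" if C: "C \<in> P" for C
      unfolding cover_critical_def
    proof
      fix c assume c: "c \<in> C"
      \<comment> \<open>Criticality passes from \<open>Y\<close> to \<open>C\<close>: both
        \<open>Y\<close> and \<open>Y - {c}\<close> split off the same part \<open>Y - C\<close>,
        whose contribution cancels.\<close>
      have ap: "apart C (Y - C)" using apart[OF C] UP unfolding apart_def by blast
      then have ap': "apart (C - {c}) (Y - C)" unfolding apart_def by blast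
      have "cover_number (C - {c}) + cover_number (Y - C) = cover_number ((C - {c}) \<union> (Y - C))"
        using PV[OF C] YV ap' by (intro cover_number_Un_apart[symmetric]) auto
      also have "(C - {c}) \<union> (Y - C) = Y - {c}" using c PY[OF C] by auto
      also have "cover_number \<dots> < cover_number Y"
        using critY c PY[OF C] by (auto simp: cover_critical_def)
      also have "cover_number Y = cover_number (C \<union> (Y - C))" using PY[OF C] by (simp add: Un_absorb1)
      also have "\<dots> = cover_number C + cover_number (Y - C)"
        using PV[OF C] YV ap by (intro cover_number_Un_apart) auto
      finally show "cover_number (C - {c}) < cover_number C" by simp
    qed
    have "card Y < card X" using Y(1) x finX by (intro psubset_card_mono) auto
    have "2 * k = (\<Sum>C\<in>P. 2 * cover_number C)" by (simp add: kP sum_distrib_left)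
    also have "\<dots> \<le> (\<Sum>C\<in>P. card C + 1)"
    proof (rule sum_mono)
      fix C assume C: "C \<in> P"
      have "card C < card X" using card_mono[OF finY PY[OF C]] \<open>card Y < card X\<close> by simp
      then show "2 * cover_number C \<le> card C + 1"
        using less.hyps PV conn critP C by blast
    qed
    also have "\<dots> = (\<Sum>C\<in>P. card C) + card P" by (simp only: sum.distrib card_eq_sum)
    also have "(\<Sum>C\<in>P. card C) = card Y"
      using product_partition[OF P] finite_subset[OF PY finY] by simp
    finally have "2 * k \<le> card Y + card P" .
    moreover have "card Y + card R = card X"
      using Y(1) finX finY by (simp add: R_def card_Diff_subset card_mono subset_Diff_insert)
    \<comment> \<open>The chain is
      \<open>card X + 2 \<le> 2 * cover_number X \<le> 2 * k + 2\<close>, whence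
      \<open>card Y + card R = card X \<le> 2 * k \<le> card Y + card P\<close>.\<close>
    ultimately have RP: "card R \<le> card P" using large k by linarith

    define Nb where "Nb C = {r \<in> R. \<exists>c\<in>C. F {r, c}}" for C
    have "Nb C \<noteq> {}" if C: "C \<in> P" for C
    proof -
      have "C \<noteq> {}" using C P by (auto simp: partition_on_def)
      moreover have "C \<subseteq> X" "C \<noteq> X" using PY[OF C] Y(1) x by auto
      ultimately obtain a b where ab: "a \<in> C" "b \<in> X - C" "F {a, b}"
        using less.prems(2) unfolding skeleton_connected_def by blast
      have "b \<notin> Y"
      proof
        assume "b \<in> Y"
        then obtain D where "D \<in> P" "b \<in> D" using UP by blast
        with ab apart[OF C, of D] show False by (auto simp: apart_def)
      qed
      with ab have "b \<in> Nb C" by (auto simp: Nb_def R_def insert_commute)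
      then show ?thesis by blast
    qed
    moreover have "Nb C \<subseteq> R" for C by (auto simp: Nb_def)
    ultimately have "\<exists>Q m. Q \<noteq> {} \<and> Q \<subseteq> R \<and> inj_on m Q \<and>
        (\<forall>q\<in>Q. m q \<in> P \<and> q \<in> Nb (m q) \<and> Nb (m q) \<subseteq> Q)"
      by (rule saturated_matching_exists[OF R finP RP])
    then obtain Q m where Q: "Q \<noteq> {}" "Q \<subseteq> R" and inj: "inj_on m Q"
      and mQ: "\<forall>q\<in>Q. m q \<in> P \<and> q \<in> Nb (m q) \<and> Nb (m q) \<subseteq> Q"
      by auto
    have m: "m q \<in> P" "q \<in> Nb (m q)" "Nb (m q) \<subseteq> Q" if "q \<in> Q" for q
      using mQ that by auto
    have finQ: "finite Q" using Q(2) R(1) by (rule finite_subset)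
    have QX: "Q \<subseteq> X" using Q(2) by (auto simp: R_def)
    \<comment> \<open>\<open>U\<close> collects the matched components and \<open>W\<close> the rest
      of \<open>X - Q\<close>, so that \<open>X - Q\<close> is the union of \<open>W\<close> and
      \<open>U\<close>.\<close>
    define U where "U = \<Union>(m ` Q)"
    define W where "W = X - Q - U"
    have UY: "U \<subseteq> Y" using m(1) PY by (auto simp: U_def)
    have absorb: "cover_number (insert q (m q)) \<le> cover_number (m q)" if q: "q \<in> Q" for q
    proof -
      obtain c where c: "c \<in> m q" "F {q, c}" using m(2)[OF q] by (auto simp: Nb_def)
      have "insert q (m q) = (m q - {c}) \<union> {q, c}" using c by auto
      then have "cover_number (insert q (m q)) \<le> cover_number (m q - {c}) + cover_number {q, c}"
        using PV[OF m(1)[OF q]] q QX XV c(1) cover_number_Un_le[of "m q - {c}" "{q, c}"] by auto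
      also have "\<dots> \<le> cover_number (m q - {c}) + 1" using cover_number_face[OF c(2)] by simp
      also have "\<dots> \<le> cover_number (m q)"
        using critP[OF m(1)[OF q]] c(1) by (auto simp: cover_critical_def Suc_le_eq)
      finally show ?thesis .
    qed
    \<comment> \<open>A neighbour of a matched component either lies in \<open>Y\<close>, hence in
      the same component, or lies in \<open>R\<close>, hence in \<open>Q\<close> by saturation.
      Neither kind belongs to \<open>W\<close>.\<close>
    have apU: "apart W U"
      unfolding apart_def
    proof (intro ballI notI)
      fix w u assume w: "w \<in> W" and u: "u \<in> U" and wu: "F {w, u}"
      from u obtain q where q: "q \<in> Q" "u \<in> m q" by (auto simp: U_def)
      show False
      proof (cases "w \<in> Y")
        case True
        then obtain D where D: "D \<in> P" "w \<in> D" using UP by blast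
        with w q have "D \<noteq> m q" by (auto simp: W_def U_def)
        with apart[OF D(1) m(1)[OF q(1)]] D(2) q(2) wu show False by (auto simp: apart_def)
      next
        case False
        with w wu q have "w \<in> Nb (m q)" by (auto simp: W_def R_def Nb_def)
        with m(3)[OF q(1)] w show False by (auto simp: W_def)
      qed
    qed
    have "X = W \<union> (\<Union>q\<in>Q. insert q (m q))" using QX UY Y(1) by (auto simp: W_def U_def)
    then have "cover_number X \<le> cover_number W + cover_number (\<Union>q\<in>Q. insert q (m q))"
      using cover_number_Un_le[of W "\<Union>q\<in>Q. insert q (m q)"] XV by auto
    also have "\<dots> \<le> cover_number W + (\<Sum>q\<in>Q. cover_number (insert q (m q)))"
      using finQ PV m(1) QX XV by (intro add_left_mono cover_number_UN_le) auto
    also have "\<dots> \<le> cover_number W + (\<Sum>q\<in>Q. cover_number (m q))"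
      by (intro add_left_mono sum_mono absorb)
    \<comment> \<open>Injectivity of \<open>m\<close> matters here: the summands belong to distinct,
      hence apart, components, so no component is counted twice.\<close>
    also have "(\<Sum>q\<in>Q. cover_number (m q)) = cover_number U"
      unfolding U_def
    proof (rule cover_number_UN_apart[symmetric, OF finQ])
      show "m q \<subseteq> V" if "q \<in> Q" for q using PV m(1) that by blast
      show "apart (m q) (m q')" if "q \<in> Q" "q' \<in> Q" "q \<noteq> q'" for q q'
        using that m(1) inj by (intro apart) (auto dest: inj_onD)
    qed
    also have "cover_number W + cover_number U = cover_number (W \<union> U)"
      using apU XV UY YV by (intro cover_number_Un_apart[symmetric]) (auto simp: W_def)
    also have "W \<union> U = X - Q" using UY Y(1) Q(2) by (auto simp: W_def R_def)
    also have "cover_number \<dots> < cover_number X"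
      using XV less.prems(3) QX Q(1) by (rule cover_critical_diff)
    finally show False by simp
  qed
qed

section \<open>From covers to colourings of digraphs\<close>

lemma partition_into_faces_exists:
  assumes "X \<subseteq> V"
  shows "\<exists>P. partition_on X P \<and> (\<forall>C\<in>P. F C) \<and> card P \<le> cover_number X"
proof -
  obtain P where P: "covers P X" "card P = cover_number X"
    using assms by (rule minimum_cover_exists)
  have "\<forall>x\<in>X. \<exists>C. C \<in> P \<and> x \<in> C" using P(1) by (auto simp: covers_def)
  then obtain c where c: "\<And>x. x \<in> X \<Longrightarrow> c x \<in> P \<and> x \<in> c x" by metis
  \<comment> \<open>The classes are the fibres of a choice of one covering face per point. Each lies
    inside its face, and empty fibres must be discarded to obtain a partition.\<close>
  define cls where "cls C = {x \<in> X. c x = C}" for C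
  have fin: "finite P" using P(1) by (simp add: covers_def)
  have "partition_on X (cls ` P - {{}})"
    using c by (intro partition_onI) (auto simp: cls_def disjnt_def)
  moreover have "F D" if "D \<in> cls ` P - {{}}" for D
  proof -
    from that obtain C where "C \<in> P" "D = cls C" by blast
    moreover have "cls C \<subseteq> C" using c by (auto simp: cls_def)
    ultimately show ?thesis using P(1) face_subset by (auto simp: covers_def)
  qed
  moreover have "card (cls ` P - {{}}) \<le> card P"
    using fin by (meson card_image_le card_mono Diff_subset finite_imageI order_trans)
  ultimately show ?thesis using P(2) by metis
qed

end

definition acyclic_set :: "'a pair_pre_digraph \<Rightarrow> 'a set \<Rightarrow> bool" where
  "acyclic_set G C \<longleftrightarrow> \<not> (\<exists>c. pre_digraph.cycle (induce_subgraph (with_proj G) C) c)"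

text \<open>The functions \<open>cas\<close> and \<open>awalk_verts\<close> depend only on the tail
  and head maps, which restriction leaves unchanged. Passing to the larger set thus only enlarges
  the vertex and arc sets in which the walk must lie.\<close>

lemma cycle_mono:
  assumes "pre_digraph.cycle (G \<restriction> B) c" "B \<subseteq> A"
  shows "pre_digraph.cycle (G \<restriction> A) c"
proof -
  have cas: "pre_digraph.cas (G \<restriction> B) u p v = pre_digraph.cas (G \<restriction> A) u p v" for u p v
    by (induction p arbitrary: u) (simp_all add: pre_digraph.cas.simps)
  have vs: "pre_digraph.awalk_verts (G \<restriction> B) u p = pre_digraph.awalk_verts (G \<restriction> A) u p" for u p
    by (induction p arbitrary: u) (simp_all add: pre_digraph.awalk_verts.simps)
  show ?thesis
    using assms unfolding pre_digraph.cycle_def pre_digraph.awalk_def cas vs by auto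
qed

text \<open>The only arc that can remain is \<open>(v, u)\<close> with \<open>v \<noteq> u\<close>.
  A closed walk of length one would make it a loop, and a longer walk would have to follow this arc
  by itself. The case \<open>u = v\<close> yields the singleton faces.\<close>

lemma acyclic_set_pair:
  assumes "pair_digraph G" "(u, v) \<notin> parcs G"
  shows "acyclic_set G {u, v}"
  unfolding acyclic_set_def
proof
  interpret pair_digraph G by fact
  let ?H = "with_proj G \<restriction> {u, v}"
  have arc: "e = (v, u)" "v \<noteq> u" if "e \<in> arcs ?H" for e
    using that assms(2) no_loops[of e] by (cases e; auto)+
  assume "\<exists>c. pre_digraph.cycle ?H c"
  then obtain w p where p: "set p \<subseteq> arcs ?H" "pre_digraph.cas ?H w p w" "p \<noteq> []"
    by (auto simp: pre_digraph.cycle_def pre_digraph.awalk_def)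
  then obtain e es where es: "p = e # es" by (cases p) auto
  have "e \<in> arcs ?H" using p(1) es by simp
  then have e: "e = (v, u)" "v \<noteq> u" by (rule arc)+
  show False
  proof (cases es)
    case Nil
    with p(2) es e show False by (auto simp: pre_digraph.cas.simps)
  next
    case (Cons e' es')
    with p(1) es have "e' \<in> arcs ?H" by simp
    then have "e' = (v, u)" by (rule arc)
    with p(2) es e Cons show False by (auto simp: pre_digraph.cas.simps)
  qed
qed

lemma face_family_acyclic_set:
  assumes "pair_digraph G"
  shows "face_family (pverts G) (acyclic_set G)"
proof
  interpret pair_digraph G by fact
  show "finite (pverts G)" by simp
  show "acyclic_set G {x}" for x
    using acyclic_set_pair[OF assms, of x x] no_loops[of "(x, x)"] by auto
  show "acyclic_set G B" if "acyclic_set G A" "B \<subseteq> A" for A B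
    using that cycle_mono unfolding acyclic_set_def by blast
qed

lemma acyclic_colouring_induce:
  "acyclic_colouring (with_proj G \<restriction> X) P \<longleftrightarrow> partition_on X P \<and> (\<forall>C\<in>P. acyclic_set G C)"
proof -
  have "(with_proj G \<restriction> X) \<restriction> C = with_proj G \<restriction> C" if "C \<subseteq> X" for C
    using that by (auto simp: induce_subgraph_def)
  moreover have "C \<subseteq> X" if "partition_on X P" "C \<in> P" for C
    using that by (auto simp: partition_on_def)
  ultimately show ?thesis
    unfolding acyclic_colouring_def acyclic_set_def induce_subgraph_verts by metis
qed

text \<open>A minimum cover can be turned into a colouring with no more classes, and conversely
  every colouring is a cover.\<close>

lemma (in face_family) cover_number_dichromatic:
  assumes "F = acyclic_set G" "X \<subseteq> V"
  shows "cover_number X = dichromatic_number (with_proj G \<restriction> X)"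
proof -
  let ?Q = "\<lambda>n. \<exists>P. acyclic_colouring (with_proj G \<restriction> X) P \<and> card P = n"
  obtain P where P: "acyclic_colouring (with_proj G \<restriction> X) P" "card P \<le> cover_number X"
    using partition_into_faces_exists[OF assms(2)] assms(1) unfolding acyclic_colouring_induce by blast
  then have "dichromatic_number (with_proj G \<restriction> X) \<le> card P"
    unfolding dichromatic_number_def by (intro Least_le) blast
  moreover have "?Q (dichromatic_number (with_proj G \<restriction> X))"
    unfolding dichromatic_number_def using P(1) by (intro LeastI[of ?Q]) blast
  then obtain P' where P': "acyclic_colouring (with_proj G \<restriction> X) P'"
    "card P' = dichromatic_number (with_proj G \<restriction> X)" by blast
  then have "covers P' X"
    using assms finite_elements[OF finite_subset_V[OF assms(2)]]
    unfolding acyclic_colouring_induce covers_def partition_on_def by auto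
  with P'(2) have "cover_number X \<le> dichromatic_number (with_proj G \<restriction> X)"
    using cover_number_le by metis
  ultimately show ?thesis using P(2) by simp
qed

text \<open>The library's \<open>connected\<close> means strong connectivity of the symmetric
  closure. If no skeleton edge leaves \<open>A\<close>, then reachability in that closure never
  leaves \<open>A\<close>, because each of its arcs joins two vertices that are missing an arc of
  \<open>G\<close> in some direction and so form an acyclic pair.\<close>

lemma skeleton_connected_if_complement_connected:
  assumes "pair_digraph G" "Digraph_Component.connected (with_proj (complement_digraph G))"
  shows "face_family.skeleton_connected (acyclic_set G) (pverts G)"
proof -
  interpret face_family "pverts G" "acyclic_set G" using assms(1) by (rule face_family_acyclic_set)
  let ?S = "with_proj (mk_symmetric (with_proj (complement_digraph G)))"
  show ?thesis
    unfolding skeleton_connected_def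
  proof (intro allI impI, rule ccontr)
    fix A assume A: "A \<subseteq> pverts G \<and> A \<noteq> {} \<and> A \<noteq> pverts G"
      and no: "\<not> (\<exists>a\<in>A. \<exists>b\<in>pverts G - A. acyclic_set G {a, b})"
    obtain a b where ab: "a \<in> A" "b \<in> pverts G" "b \<notin> A" using A by blast
    interpret CG: wf_digraph "with_proj (complement_digraph G)"
      by unfold_locales (auto simp: complement_digraph_def)
    interpret S: pair_wf_digraph "mk_symmetric (with_proj (complement_digraph G))" ..
    have "a \<rightarrow>\<^sup>*\<^bsub>?S\<^esub> b"
      using assms(2) ab A
      by (auto simp: Digraph_Component.connected_def strongly_connected_def complement_digraph_def)
    then have "b \<in> A"
    proof (induction rule: S.reachable_induct)
      case (step x y)
      from step.hyps(2) have "y \<in> pverts G" "(x, y) \<notin> parcs G \<or> (y, x) \<notin> parcs G"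
        by (auto simp: parcs_mk_symmetric complement_digraph_def)
      then have "acyclic_set G {x, y}"
        using acyclic_set_pair[OF assms(1), of x y] acyclic_set_pair[OF assms(1), of y x]
        by (auto simp: insert_commute)
      with no step.IH \<open>y \<in> pverts G\<close> show ?case by blast
    qed (use ab in simp)
    with ab show False by simp
  qed
qed

theorem theorem1:
  fixes G :: "'a pair_pre_digraph" and k :: nat
  assumes "k > 0"
    and "pair_digraph G"
    and "vertex_critical k (with_proj G)"
    and "card (pverts G) \<le> 2 * k - 2"
  shows "\<not> Digraph_Component.connected (with_proj (complement_digraph G))"
proof
  assume conn: "Digraph_Component.connected (with_proj (complement_digraph G))"
  interpret pair_digraph G by fact
  interpret C: face_family "pverts G" "acyclic_set G" using assms(2) by (rule face_family_acyclic_set)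
  \<comment> \<open>Criticality speaks of \<open>G\<close> itself while cover numbers are tied to
    induced subgraphs; this identity links the two.\<close>
  have "with_proj G \<restriction> pverts G = with_proj G"
    by (auto dest: in_arcsD1 in_arcsD2 simp: induce_subgraph_def with_proj_def)
  then have k: "C.cover_number (pverts G) = k"
    using C.cover_number_dichromatic[OF refl subset_refl] assms(3) by (simp add: vertex_critical_def)
  have "C.cover_critical (pverts G)"
    unfolding C.cover_critical_def
  proof
    fix x assume x: "x \<in> pverts G"
    let ?H = "with_proj G \<restriction> (pverts G - {x})"
    have "induced_subgraph ?H (with_proj G)" by (rule induced_induce) auto
    moreover have "verts ?H \<noteq> verts (with_proj G)" using x by auto
    then have "?H \<noteq> with_proj G" by metis
    ultimately have "dichromatic_number ?H < k" using assms(3) by (simp add: vertex_critical_def)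
    then show "C.cover_number (pverts G - {x}) < C.cover_number (pverts G)"
      using C.cover_number_dichromatic[OF refl, of "pverts G - {x}"] k by auto
  qed
  then have "2 * C.cover_number (pverts G) \<le> card (pverts G) + 1"
    using skeleton_connected_if_complement_connected[OF assms(2) conn]
    by (intro C.twice_cover_number_le) auto
  \<comment> \<open>As \<open>k > 0\<close>, the truncated subtraction in \<open>2 * k - 2\<close>
    is exact, and \<open>2 * k \<le> card (pverts G) + 1 \<le> 2 * k - 1\<close> is absurd.\<close>
  with k assms(1,4) show False by simp
qed

end
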